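(* Let $K$ be a field and let $F, N \ge 1$ be integers. Let $\mathbf{A}^{(1)}, \dots, \mathbf{A}^{(N)}$ be $F \times F$ matrices over $K$, and let $\mathbf{X}$ and $\mathbf{Y}$ be $N \times N$ matrices over $K$. For $1 \le n \le N$, let $\mathbf{x}^{(n)}$ be the $n$-th column of $\mathbf{X}$, let $\mathbf{y}^{(n)}$ be the $n$-th column of $\mathbf{Y}$, and set $\mathbf{B}^{(n)} = \mathbf{x}^{(n)} {\mathbf{y}^{(n)}}^{T}$, an $N \times N$ matrix. Let $$\mathbf{G} = \sum_{n=1}^{N} \mathbf{A}^{(n)} \otimes \mathbf{B}^{(n)},$$ which is an $FN \times FN$ matrix. Then $$\det(\mathbf{G}) = \left( \prod_{n=1}^{N} \det(\mathbf{A}^{(n)}) \right) \det(\mathbf{X})^{F} \det(\mathbf{Y})^{F}.$$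
   Context: Here $\otimes$ denotes the Kronecker product of matrices: for an $F \times F$ matrix $\mathbf{A}$ and an $N \times N$ matrix $\mathbf{B}$, $\mathbf{A} \otimes \mathbf{B}$ is the $FN \times FN$ block matrix whose $(i,j)$ block (for $1 \le i,j \le F$) is the $N \times N$ matrix $\mathbf{A}_{ij}\mathbf{B}$. The vectors $\mathbf{x}^{(n)}, \mathbf{y}^{(n)}$ are regarded as column vectors of length $N$, and $T$ denotes transpose (without conjugation). The number $N$ of summands equals the size of the matrices $\mathbf{X}$, $\mathbf{Y}$ and $\mathbf{B}^{(n)}$. *)

theory Defs
  imports "Jordan_Normal_Form.Determinant"
begin

text \<open>
  Matrices are those of Jordan_Normal_Form: dimensions are natural numbers, and rows and columns
  are numbered from 0. Row \<open>i\<close> of the Kronecker product is therefore row \<open>i mod dim_row B\<close>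
  inside block row \<open>i div dim_row B\<close>, and likewise for columns.
\<close>

definition kronecker :: "'a :: times mat \<Rightarrow> 'a mat \<Rightarrow> 'a mat" where
  "kronecker A B = mat (dim_row A * dim_row B) (dim_col A * dim_col B)
     (\<lambda>(i, j). A $$ (i div dim_row B, j div dim_col B) * B $$ (i mod dim_row B, j mod dim_col B))"

definition column_mat :: "'a vec \<Rightarrow> 'a mat" where
  "column_mat v = mat_of_cols (dim_vec v) [v]"

lemma kronecker_carrier:
  assumes "A \<in> carrier_mat r c" "B \<in> carrier_mat p q"
  shows "kronecker A B \<in> carrier_mat (r * p) (c * q)"
  using assms by (auto simp: kronecker_def)

lemma kronecker_block:
  assumes A: "A \<in> carrier_mat r c" and B: "B \<in> carrier_mat p q"
    and "i < r" "j < c" "k < p" "l < q"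
  shows "kronecker A B $$ (i * p + k, j * q + l) = (A $$ (i, j) \<cdot>\<^sub>m B) $$ (k, l)"
proof -
  have "i * p + k < Suc i * p" "Suc i * p \<le> r * p"
    using assms by (simp, intro mult_le_mono1, simp)
  moreover have "j * q + l < Suc j * q" "Suc j * q \<le> c * q"
    using assms by (simp, intro mult_le_mono1, simp)
  ultimately have "i * p + k < r * p" "j * q + l < c * q"
    by linarith+
  then show ?thesis
    using assms by (auto simp: kronecker_def)
qed

end

theory Submission
  imports Defs
begin

text \<open>
  With \<open>I\<close> the identity of size \<open>F\<close>, the mixed product rule gives
  \<open>G = (I \<otimes> X) D (I \<otimes> Y\<^sup>T)\<close>, where \<open>D = \<Sum>n. A n \<otimes> E\<^sub>n\<^sub>n\<close>. The outer factors are block diagonal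
  with \<open>F\<close> equal blocks. Exchanging the two tensor factors conjugates \<open>D\<close> by a permutation into
  the block diagonal matrix with blocks \<open>A 0, \<dots>, A (N - 1)\<close>.
\<close>

text \<open>For a constant family \<open>\<lambda>_. X\<close> this is \<open>I \<otimes> X\<close>
  with \<open>I\<close> of size \<open>m\<close>, the form taken by both outer factors.\<close>

definition block_diag :: "nat \<Rightarrow> nat \<Rightarrow> (nat \<Rightarrow> 'a :: zero mat) \<Rightarrow> 'a mat" where
  "block_diag m k A = mat (m * k) (m * k)
     (\<lambda>(i, j). if i div k = j div k then A (i div k) $$ (i mod k, j mod k) else 0)"

lemma block_diag_carrier: "block_diag m k A \<in> carrier_mat (m * k) (m * k)"
  by (simp add: block_diag_def)

lemma index_block_diag:
  "i < m * k \<Longrightarrow> j < m * k \<Longrightarrow>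
   block_diag m k A $$ (i, j) = (if i div k = j div k then A (i div k) $$ (i mod k, j mod k) else 0)"
  by (simp add: block_diag_def)

lemma block_index_less:
  fixes a b m k :: nat
  assumes "a < m" "b < k"
  shows "a * k + b < m * k"
proof -
  have "a * k + b < Suc a * k"
    using assms by simp
  also have "\<dots> \<le> m * k"
    using assms by (intro mult_le_mono1) simp
  finally show ?thesis .
qed

text \<open>Splitting off the last block makes the determinant computable by induction through the
  rule for block triangular matrices.\<close>

lemma block_diag_Suc:
  assumes "A m \<in> carrier_mat k k"
  shows "block_diag (Suc m) k A = four_block_mat (block_diag m k A) (0\<^sub>m (m * k) k) (0\<^sub>m k (m * k)) (A m)"
proof (rule eq_matI)
  \<comment> \<open>An index past the first \<open>m\<close> blocks lies in the last one, at offset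
    \<open>r - m * k\<close>.\<close>
  have last: "r div k = m" "r mod k = r - m * k" if "r < Suc m * k" "\<not> r < m * k" for r
  proof -
    have "k > 0"
      using that by (cases k) auto
    have "r - m * k < k"
      using that by auto
    moreover have "r = m * k + (r - m * k)"
      using that by simp
    ultimately show "r div k = m" "r mod k = r - m * k"
      by (metis div_less div_mult_self3 add.right_neutral \<open>k > 0\<close> less_numeral_extra(3),
          metis mod_less mod_mult_self3)
  qed
  fix i j
  assume "i < dim_row (four_block_mat (block_diag m k A) (0\<^sub>m (m * k) k) (0\<^sub>m k (m * k)) (A m))"
    and "j < dim_col (four_block_mat (block_diag m k A) (0\<^sub>m (m * k) k) (0\<^sub>m k (m * k)) (A m))"
  then have "i < Suc m * k" "j < Suc m * k"
    using assms by (auto simp: block_diag_def)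
  then show "block_diag (Suc m) k A $$ (i, j)
      = four_block_mat (block_diag m k A) (0\<^sub>m (m * k) k) (0\<^sub>m k (m * k)) (A m) $$ (i, j)"
    using assms last[of i] last[of j] less_mult_imp_div_less[of i m k] less_mult_imp_div_less[of j m k]
    by (cases "i < m * k"; cases "j < m * k") (auto simp: block_diag_def)
qed (use assms in \<open>auto simp: block_diag_def\<close>)

lemma det_block_diag:
  fixes A :: "nat \<Rightarrow> 'a :: idom mat"
  assumes "\<And>n. n < m \<Longrightarrow> A n \<in> carrier_mat k k"
  shows "det (block_diag m k A) = (\<Prod>n<m. det (A n))"
  using assms
proof (induction m)
  case 0
  show ?case
    using block_diag_carrier[of 0 k A] by simp
next
  case (Suc m)
  have "det (block_diag (Suc m) k A) = det (block_diag m k A) * det (A m)"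
    unfolding block_diag_Suc[of A m k, OF Suc.prems[OF lessI]]
    by (rule det_four_block_mat_lower_left_zero[OF block_diag_carrier _ refl Suc.prems[OF lessI]]) simp
  with Suc show ?case
    by simp
qed

text \<open>The sign of \<open>p\<close> enters once for the rows and once for the columns, and its
  square is 1.\<close>

lemma det_permute_rows_cols:
  fixes A :: "'a :: comm_ring_1 mat"
  assumes A: "A \<in> carrier_mat n n" and p: "p permutes {0..<n}"
  shows "det (mat n n (\<lambda>(i, j). A $$ (p i, p j))) = det A"
proof -
  define B where "B = mat n n (\<lambda>(i, j). A $$ (p i, j))"
  define C where "C = mat n n (\<lambda>(i, j). A $$ (p i, p j))"
  have p_less: "p i < n" if "i < n" for i
    using permutes_in_image[OF p, of i] that by simp
  \<comment> \<open>Permuting the columns of \<open>B\<close> is permuting the rows of its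
    transpose, so the rule for rows serves a second time.\<close>
  have "transpose_mat C = mat n n (\<lambda>(i, j). transpose_mat B $$ (p i, j))"
    by (rule eq_matI) (auto simp: B_def C_def p_less)
  moreover have "det (mat n n (\<lambda>(i, j). transpose_mat B $$ (p i, j))) = signof p * det (transpose_mat B)"
    by (rule det_permute_rows[OF _ p]) (simp add: B_def)
  ultimately have "det (transpose_mat C) = signof p * det (transpose_mat B)"
    by simp
  moreover have "det (transpose_mat C) = det C"
    by (rule det_transpose[of _ n]) (simp add: C_def)
  moreover have "det (transpose_mat B) = det B"
    by (rule det_transpose[of _ n]) (simp add: B_def)
  moreover have "det B = signof p * det A"
    unfolding B_def by (rule det_permute_rows[OF A p])
  moreover have "signof p * signof p = (1 :: 'a)"
    by (simp add: sign_def)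
  ultimately show ?thesis
    by (simp add: C_def flip: mult.assoc)
qed

text \<open>The perfect shuffle: \<open>a * k + b\<close> with \<open>a < m\<close> and
  \<open>b < k\<close> goes to \<open>b * m + a\<close>. Fixing all indices outside the range is
  what \<open>permutes\<close> demands.\<close>

definition swap_factors :: "nat \<Rightarrow> nat \<Rightarrow> nat \<Rightarrow> nat" where
  "swap_factors m k r = (if r < m * k then r mod k * m + r div k else r)"

lemma swap_factors_less: "r < m * k \<Longrightarrow> swap_factors m k r < m * k"
  using block_index_less[of "r mod k" k "r div k" m]
  by (cases "k = 0") (auto simp: swap_factors_def less_mult_imp_div_less mult.commute)

lemma swap_factors_div_mod:
  assumes "r < m * k"
  shows "swap_factors m k r div m = r mod k" "swap_factors m k r mod m = r div k"
  using less_mult_imp_div_less[OF assms] assms by (auto simp: swap_factors_def)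

lemma swap_factors_permutes: "swap_factors m k permutes {0..<m * k}"
proof (rule bij_imp_permutes)
  show "bij_betw (swap_factors m k) {0..<m * k} {0..<m * k}"
  proof (rule bij_betw_byWitness[where f' = "swap_factors k m"])
    \<comment> \<open>Stated for all \<open>m\<close> and \<open>k\<close>, so that exchanging them
      yields the other composition as well.\<close>
    have "swap_factors k m (swap_factors m k r) = r" if "r < m * k" for m k r
      using swap_factors_less[OF that] swap_factors_div_mod[OF that]
      by (simp add: swap_factors_def[of k m] mult.commute[of k m])
    from this[of _ m k] this[of _ k m]
    show "\<forall>r\<in>{0..<m * k}. swap_factors k m (swap_factors m k r) = r"
      "\<forall>r\<in>{0..<m * k}. swap_factors m k (swap_factors k m r) = r"
      by (auto simp: mult.commute)
  qed (use swap_factors_less[of _ m k] swap_factors_less[of _ k m] in \<open>auto simp: mult.commute\<close>)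
qed (auto simp: swap_factors_def)

text \<open>This is the sum of \<open>A n \<otimes> E\<^sub>n\<^sub>n\<close> over
  \<open>n < k\<close>, with matrix units of size \<open>k\<close>: every \<open>k\<close> by
  \<open>k\<close> block is diagonal, and its \<open>n\<close>-th diagonal entry comes from
  \<open>A n\<close>.\<close>

definition diag_blocks :: "nat \<Rightarrow> nat \<Rightarrow> (nat \<Rightarrow> 'a :: zero mat) \<Rightarrow> 'a mat" where
  "diag_blocks m k A = mat (m * k) (m * k)
     (\<lambda>(i, j). if i mod k = j mod k then A (i mod k) $$ (i div k, j div k) else 0)"

text \<open>The shuffle exchanges quotient and remainder of each index, which turns this matrix into
  \<open>block_diag k m A\<close>.\<close>

lemma det_diag_blocks:
  fixes A :: "nat \<Rightarrow> 'a :: idom mat"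
  assumes "\<And>n. n < k \<Longrightarrow> A n \<in> carrier_mat m m"
  shows "det (diag_blocks m k A) = (\<Prod>n<k. det (A n))"
proof -
  have "diag_blocks m k A
      = mat (m * k) (m * k) (\<lambda>(i, j). block_diag k m A $$ (swap_factors m k i, swap_factors m k j))"
    by (rule eq_matI)
      (auto simp: diag_blocks_def index_block_diag swap_factors_less swap_factors_div_mod mult.commute[of k m])
  moreover have "block_diag k m A \<in> carrier_mat (m * k) (m * k)"
    using block_diag_carrier[of k m A] by (simp add: mult.commute)
  ultimately show ?thesis
    by (simp add: det_permute_rows_cols swap_factors_permutes det_block_diag assms)
qed

text \<open>The indices with quotient \<open>b\<close> are exactly \<open>b * k + l\<close> for
  \<open>l < k\<close>. Multiplying by a block diagonal matrix produces sums of this kind.\<close>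

lemma sum_within_block:
  fixes f :: "nat \<Rightarrow> 'a :: comm_monoid_add"
  assumes "b < m"
  shows "(\<Sum>r<m * k. if r div k = b then f r else 0) = (\<Sum>l<k. f (b * k + l))"
proof -
  have "(\<Sum>r<m * k. if r div k = b then f r else 0) = sum f {r \<in> {..<m * k}. r div k = b}"
    by (rule sum.inter_filter[symmetric]) simp
  also have "\<dots> = (\<Sum>l<k. f (b * k + l))"
  proof (rule sum.reindex_bij_witness[where i = "\<lambda>l. b * k + l" and j = "\<lambda>r. r mod k"])
    fix r
    assume r: "r \<in> {r \<in> {..<m * k}. r div k = b}"
    then show "b * k + r mod k = r"
      by auto
    then show "f (b * k + r mod k) = f r"
      by simp
    show "r mod k \<in> {..<k}"
      using r by (cases "k = 0") auto
  qed (use block_index_less[OF assms, of _ k] in auto)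
  finally show ?thesis .
qed

text \<open>The outer factors confine the two summation indices to the blocks of \<open>i\<close>
  and \<open>j\<close>, and the middle factor forces equal remainders. Only the common remainder
  \<open>n\<close> is left to sum over.\<close>

lemma block_diag_diag_blocks_block_diag:
  fixes A :: "nat \<Rightarrow> 'a :: comm_semiring_1 mat"
  assumes "X \<in> carrier_mat k k" "Y \<in> carrier_mat k k"
    and i: "i < m * k" and j: "j < m * k"
  shows "(block_diag m k (\<lambda>_. X) * diag_blocks m k A * block_diag m k (\<lambda>_. transpose_mat Y)) $$ (i, j)
     = (\<Sum>n<k. A n $$ (i div k, j div k) * (X $$ (i mod k, n) * Y $$ (j mod k, n)))"
proof -
  have k: "k > 0"
    using i by (cases k) auto
  have XD: "(block_diag m k (\<lambda>_. X) * diag_blocks m k A) $$ (i, r)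
      = X $$ (i mod k, r mod k) * A (r mod k) $$ (i div k, r div k)" if r: "r < m * k" for r
  proof -
    have "(block_diag m k (\<lambda>_. X) * diag_blocks m k A) $$ (i, r)
        = (\<Sum>s<m * k. if s div k = i div k then X $$ (i mod k, s mod k) *
            (if s mod k = r mod k then A (s mod k) $$ (s div k, r div k) else 0) else 0)"
      using i r by (auto simp: block_diag_def diag_blocks_def scalar_prod_def atLeast0LessThan intro!: sum.cong)
    \<comment> \<open>Inside the block of \<open>i\<close> the summation index is
      \<open>i div k * k + l\<close>, and the middle factor keeps only
      \<open>l = r mod k\<close>.\<close>
    also have "\<dots> = (\<Sum>l<k. if l = r mod k
        then X $$ (i mod k, r mod k) * A (r mod k) $$ (i div k, r div k) else 0)"
      by (subst sum_within_block[OF less_mult_imp_div_less[OF i]], intro sum.cong refl)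
        (use k in simp)
    finally show ?thesis
      using k by (simp add: sum.delta)
  qed
  have "(block_diag m k (\<lambda>_. X) * diag_blocks m k A * block_diag m k (\<lambda>_. transpose_mat Y)) $$ (i, j)
      = (\<Sum>r<m * k. (block_diag m k (\<lambda>_. X) * diag_blocks m k A) $$ (i, r)
          * block_diag m k (\<lambda>_. transpose_mat Y) $$ (r, j))"
    using i j by (simp add: block_diag_def diag_blocks_def scalar_prod_def atLeast0LessThan)
  also have "\<dots> = (\<Sum>r<m * k. if r div k = j div k
      then X $$ (i mod k, r mod k) * A (r mod k) $$ (i div k, r div k) * Y $$ (j mod k, r mod k) else 0)"
    using assms k by (intro sum.cong) (auto simp: XD index_block_diag)
  also have "\<dots> = (\<Sum>n<k. A n $$ (i div k, j div k) * (X $$ (i mod k, n) * Y $$ (j mod k, n)))"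
    by (subst sum_within_block[OF less_mult_imp_div_less[OF j]]) (auto intro!: sum.cong simp: ac_simps)
  finally show ?thesis .
qed

text \<open>Addition in the group of \<open>nr\<close> by \<open>nc\<close> matrices is entrywise,
  so the entries of \<open>G\<close> become ordinary sums in the field.\<close>

lemma finsum_module_mat:
  fixes M :: "'i \<Rightarrow> 'a :: comm_ring_1 mat"
  assumes "finite S" and "\<And>n. n \<in> S \<Longrightarrow> M n \<in> carrier_mat nr nc"
  shows "(\<Oplus>\<^bsub>module_mat TYPE('a) nr nc\<^esub>n\<in>S. M n) = mat nr nc (\<lambda>(i, j). \<Sum>n\<in>S. M n $$ (i, j))"
proof -
  interpret abelian_group "module_mat TYPE('a) nr nc"
    by (rule abelian_group_mat)
  show ?thesis
    using assms
  proof (induction S)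
    case empty
    show ?case
      by (auto simp: module_mat_simps)
  next
    case (insert n S)
    then have "(\<Oplus>\<^bsub>module_mat TYPE('a) nr nc\<^esub>n\<in>insert n S. M n)
        = M n + mat nr nc (\<lambda>(i, j). \<Sum>n\<in>S. M n $$ (i, j))"
      by (subst finsum_insert) (auto simp: module_mat_simps)
    then show ?case
      using insert by auto
  qed
qed

theorem mainTheorem1:
  fixes F N :: nat
    and A B :: "nat \<Rightarrow> 'k :: field mat"
    and X Y G :: "'k mat"
  assumes "F \<ge> 1" and "N \<ge> 1"
    and "\<And>n. n < N \<Longrightarrow> A n \<in> carrier_mat F F"
    and "X \<in> carrier_mat N N" and "Y \<in> carrier_mat N N"
    and "\<And>n. n < N \<Longrightarrow> B n = column_mat (col X n) * transpose_mat (column_mat (col Y n))"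
    and "G = (\<Oplus>\<^bsub>module_mat TYPE('k) (F * N) (F * N)\<^esub>n\<in>{..<N}. kronecker (A n) (B n))"
  shows "det G = (\<Prod>n<N. det (A n)) * det X ^ F * det Y ^ F"
proof -
  note A = assms(3) and X = assms(4) and Y = assms(5)
  have B: "B n \<in> carrier_mat N N" if "n < N" for n
    using that X Y by (auto simp: assms(6) column_mat_def)
  have B_index: "B n $$ (i, j) = X $$ (i, n) * Y $$ (j, n)" if "n < N" "i < N" "j < N" for n i j
    using that X Y by (auto simp: assms(6) column_mat_def scalar_prod_def mat_of_cols_def)
  let ?X = "block_diag F N (\<lambda>_. X)" and ?D = "diag_blocks F N A"
    and ?Y = "block_diag F N (\<lambda>_. transpose_mat Y)"
  have "G = mat (F * N) (F * N) (\<lambda>(i, j). \<Sum>n<N. kronecker (A n) (B n) $$ (i, j))"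
    unfolding assms(7) by (rule finsum_module_mat) (auto intro: kronecker_carrier A B)
  also have "\<dots> = ?X * ?D * ?Y"
  proof (rule eq_matI)
    fix i j
    assume "i < dim_row (?X * ?D * ?Y)" "j < dim_col (?X * ?D * ?Y)"
    then have ij: "i < F * N" "j < F * N"
      by (auto simp: block_diag_def)
    \<comment> \<open>Since \<open>N\<close> is positive, \<open>i mod N\<close> and
      \<open>j mod N\<close> are below \<open>N\<close>, as \<open>B_index\<close> requires.\<close>
    have "kronecker (A n) (B n) $$ (i, j)
        = A n $$ (i div N, j div N) * (X $$ (i mod N, n) * Y $$ (j mod N, n))" if "n < N" for n
      using ij A[OF that] B[OF that] that assms(2) by (simp add: kronecker_def B_index)
    then show "mat (F * N) (F * N) (\<lambda>(i, j). \<Sum>n<N. kronecker (A n) (B n) $$ (i, j)) $$ (i, j)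
        = (?X * ?D * ?Y) $$ (i, j)"
      using ij by (simp add: block_diag_diag_blocks_block_diag[OF X Y])
  qed (auto simp: block_diag_def)
  finally have "det G = det (?X * ?D * ?Y)"
    by simp
  also have "\<dots> = det ?X * det ?D * det ?Y"
    using block_diag_carrier[of F N "\<lambda>_. X"] block_diag_carrier[of F N "\<lambda>_. transpose_mat Y"]
    by (simp add: det_mult[where n = "F * N"] diag_blocks_def mult_carrier_mat[where n = "F * N"])
  \<comment> \<open>The outer factors have \<open>F\<close> equal blocks each, so their products of
    determinants are powers.\<close>
  also have "\<dots> = det X ^ F * (\<Prod>n<N. det (A n)) * det Y ^ F"
    using A X Y by (simp add: det_block_diag det_diag_blocks det_transpose[OF Y])
  finally show ?thesis
    by (simp add: ac_simps)
qed

end
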